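(* Let $n,m\ge 1$ be integers and let $O$ be a partition of $n$. Then $CFG(O,n,m)$, ordered by $\le_{(n,m)}$, is a lattice.
   Context: A partition of $n$ is a sequence $x=(x_1,\ldots,x_n)$ of nonnegative integers with $x_1\ge\cdots\ge x_n$ and $\sum x_i=n$ (with $x_j=0$ for $j>n$). The $CFG(n,m)$ transition at position $i$ is allowed on a partition $x$ of $n$ when $x_i-x_{i+1}\ge m+1$, and replaces $x_i$ by $x_i-m$ and $x_j$ by $x_j+1$ for each $j\in\{i+1,\ldots,i+m\}$, leaving the other entries unchanged (the result is again a partition of $n$). For partitions $a,b$ of $n$, $b\le_{(n,m)}a$ means that $b$ can be obtained from $a$ by a (possibly empty) finite sequence of allowed transitions. $CFG(O,n,m)$ is the set of all partitions $b$ of $n$ with $b\le_{(n,m)}O$, ordered by $\le_{(n,m)}$. *)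

theory Defs
  imports "HOL-Algebra.Lattice"
begin

text \<open>
  A partition is a function on the positions \<open>1, 2, 3, \<dots>\<close>; the value at the unused index
  \<open>0\<close> is fixed to \<open>0\<close>, so that equality of functions is equality of sequences.
\<close>

definition is_partition :: "nat \<Rightarrow> (nat \<Rightarrow> nat) \<Rightarrow> bool" where
  "is_partition n x \<longleftrightarrow>
     (\<forall>i. i \<notin> {1..n} \<longrightarrow> x i = 0) \<and>
     (\<forall>i j. 1 \<le> i \<and> i \<le> j \<and> j \<le> n \<longrightarrow> x j \<le> x i) \<and>
     (\<Sum>i=1..n. x i) = n"

text \<open>The condition \<open>x\<^sub>i - x\<^sub>i\<^sub>+\<^sub>1 \<ge> m + 1\<close>, stated without truncated subtraction.\<close>

definition allowed :: "nat \<Rightarrow> nat \<Rightarrow> (nat \<Rightarrow> nat) \<Rightarrow> nat \<Rightarrow> bool" where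
  "allowed n m x i \<longleftrightarrow> i \<in> {1..n} \<and> x i \<ge> x (i + 1) + (m + 1)"

definition fire :: "nat \<Rightarrow> nat \<Rightarrow> (nat \<Rightarrow> nat) \<Rightarrow> (nat \<Rightarrow> nat)" where
  "fire m i x = (\<lambda>j. if j = i then x j - m
                      else if j \<in> {i + 1..i + m} then x j + 1
                      else x j)"

lemma is_partition_fire:
  assumes x: "is_partition n x" and i: "allowed n m x i"
  shows "is_partition n (fire m i x)"
proof -
  have i1: "1 \<le> i" "i \<le> n" and d: "x (i + 1) + (m + 1) \<le> x i"
    using i by (auto simp: allowed_def)
  have mono: "x k \<le> x j" if "1 \<le> j" "j \<le> k" for j k
    using x that by (cases "k \<le> n") (auto simp: is_partition_def)
  have "i * (m + 1) = (\<Sum>j=1..i. m + 1)" by simp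
  also have "\<dots> \<le> (\<Sum>j=1..i. x j)"
    using mono d by (intro sum_mono) (metis atLeastAtMost_iff add_leD2 order_trans)
  also have "\<dots> \<le> (\<Sum>j=1..n. x j)" using i1 by (intro sum_mono2) auto
  also have "\<dots> = n" using x by (simp add: is_partition_def)
  finally have "i * (m + 1) \<le> n" .
  moreover have "i + m \<le> i * (m + 1)" using i1 by (cases i) auto
  ultimately have im: "i + m \<le> n" by linarith
  have sub: "{1..n} \<inter> {i + 1..i + m} = {i + 1..i + m}" using im by auto
  have "fire m i x j + (if j = i then m else 0)
      = x j + (if j \<in> {i + 1..i + m} then 1 else 0)" for j
    using d by (auto simp: fire_def)
  then have "(\<Sum>j=1..n. fire m i x j + (if j = i then m else 0))
      = (\<Sum>j=1..n. x j + (if j \<in> {i + 1..i + m} then 1 else 0))"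
    by (intro sum.cong) auto
  moreover have "(\<Sum>j=1..n. if j = i then m else 0) = m" using i1 by simp
  moreover have "(\<Sum>j=1..n. if j \<in> {i + 1..i + m} then 1 else 0) = m"
    using im by (simp add: sum.If_cases sub del: atLeastAtMost_iff)
  ultimately have "(\<Sum>j=1..n. fire m i x j) = (\<Sum>j=1..n. x j)"
    by (simp add: sum.distrib del: atLeastAtMost_iff)
  moreover have "fire m i x k \<le> fire m i x j" if jk: "1 \<le> j" "j \<le> k" for j k
  proof -
    have "x k \<le> x j" using mono jk by simp
    moreover have "x i \<le> x j" if "j \<le> i" using mono jk that by simp
    moreover have "x k \<le> x (i + 1)" if "i < k" using mono that by simp
    ultimately show ?thesis using jk d by (auto simp: fire_def)
  qed
  moreover have "fire m i x j = 0" if "j \<notin> {1..n}" for j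
    using x that i1 im by (auto simp: fire_def is_partition_def)
  ultimately show ?thesis using x by (auto simp: is_partition_def)
qed

definition cfg_step :: "nat \<Rightarrow> nat \<Rightarrow> (nat \<Rightarrow> nat) \<Rightarrow> (nat \<Rightarrow> nat) \<Rightarrow> bool" where
  "cfg_step n m x y \<longleftrightarrow> is_partition n x \<and> (\<exists>i. allowed n m x i \<and> y = fire m i x)"

text \<open>The smaller element is the one reached: \<open>cfg_le n m b a\<close> renders \<open>b \<le> a\<close>.\<close>

definition cfg_le :: "nat \<Rightarrow> nat \<Rightarrow> (nat \<Rightarrow> nat) \<Rightarrow> (nat \<Rightarrow> nat) \<Rightarrow> bool" where
  "cfg_le n m b a \<longleftrightarrow> is_partition n a \<and> is_partition n b \<and> (cfg_step n m)\<^sup>*\<^sup>* a b"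

definition CFG :: "(nat \<Rightarrow> nat) \<Rightarrow> nat \<Rightarrow> nat \<Rightarrow> (nat \<Rightarrow> nat) gorder" where
  "CFG P n m = \<lparr>carrier = {b. is_partition n b \<and> cfg_le n m b P}, eq = (=), le = cfg_le n m\<rparr>"

end

theory Submission
  imports Defs
begin

text \<open>
  A partition reached from \<open>P\<close> determines how often each position has fired, because the
  effects of the positions form a triangular system. Firing elsewhere never makes an allowed
  position forbidden, so if the firing vectors \<open>s\<close> and \<open>u\<close> are attainable, then \<open>u\<close> can be
  continued to the pointwise maximum \<open>sup u s\<close> by the firings of \<open>s\<close> that exceed \<open>u\<close>. Hence
  \<open>\<le>\<close> on partitions is the reverse of the pointwise order on attainable firing vectors, and
  these are closed under pointwise maxima. Maxima give the meets; joins follow because only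
  finitely many firing vectors lie below a given one.
\<close>

text \<open>The rule \<open>en\<close> is left abstract: the exchange argument in
  \<open>shot_sup\<close> uses nothing about it but the locality assumed there.\<close>

inductive shot :: "(('a \<Rightarrow> nat) \<Rightarrow> 'a \<Rightarrow> bool) \<Rightarrow> ('a \<Rightarrow> nat) \<Rightarrow> ('a \<Rightarrow> nat) \<Rightarrow> bool"
  for en :: "('a \<Rightarrow> nat) \<Rightarrow> 'a \<Rightarrow> bool" where
  refl: "shot en s s"
| step: "shot en s t \<Longrightarrow> en t i \<Longrightarrow> shot en s (t(i := Suc (t i)))"

lemma shot_trans:
  assumes "shot en t u" "shot en s t"
  shows "shot en s u"
  using assms by induction (auto intro: shot.step)

lemma shot_le:
  assumes "shot en s t"
  shows "s \<le> t"
  using assms by induction (auto simp: le_fun_def intro: le_SucI)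

lemma shot_unchanged:
  assumes "shot en s t" and "\<And>u. \<not> en u i"
  shows "t i = s i"
  using assms by induction auto

text \<open>Replay the run to \<open>t\<close> on top of \<open>u\<close>: a firing that
  \<open>u\<close> has already made is skipped, and any other occurs where \<open>sup u t\<close>
  agrees with \<open>t\<close>, so locality permits it.\<close>

lemma shot_sup:
  assumes local: "\<And>t u i. en t i \<Longrightarrow> t \<le> u \<Longrightarrow> u i = t i \<Longrightarrow> en u i"
    and "shot en s t" and "s \<le> u"
  shows "shot en u (sup u t)"
  using assms(2,3)
proof induction
  case (refl s)
  then show ?case by (simp add: sup_absorb1 shot.refl)
next
  case (step s t i)
  then have IH: "shot en u (sup u t)" by blast
  show ?case
  proof (cases "t i < u i")
    case True
    then have "sup u (t(i := Suc (t i))) = sup u t"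
      by (auto simp: fun_eq_iff sup_fun_def sup_max)
    then show ?thesis using IH by (simp only:)
  next
    case False
    then have ti: "sup u t i = t i" by (simp add: sup_max)
    then have "sup u (t(i := Suc (t i))) = (sup u t)(i := Suc (sup u t i))"
      using False by (auto simp: fun_eq_iff sup_max)
    moreover have "en (sup u t) i"
      using local[OF step.hyps(2)] ti by simp
    ultimately show ?thesis using shot.step[OF IH] by (simp only:)
  qed
qed

lemma lattice_of_reversed_sup_closed:
  fixes S :: "'a \<Rightarrow> 'b::lattice"
  assumes eq: "eq L = (=)"
    and inj: "inj_on S (carrier L)"
    and le: "\<And>a b. a \<in> carrier L \<Longrightarrow> b \<in> carrier L \<Longrightarrow> le L b a \<longleftrightarrow> S a \<le> S b"
    and sup: "\<And>u v. u \<in> S ` carrier L \<Longrightarrow> v \<in> S ` carrier L \<Longrightarrow> sup u v \<in> S ` carrier L"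
    and bot: "b \<in> S ` carrier L" "\<And>u. u \<in> S ` carrier L \<Longrightarrow> b \<le> u"
    and fin: "\<And>v. v \<in> S ` carrier L \<Longrightarrow> finite {u \<in> S ` carrier L. u \<le> v}"
  shows "Lattice.lattice L"
proof
  fix x y assume xy: "x \<in> carrier L" "y \<in> carrier L"
  obtain z where z: "z \<in> carrier L" "sup (S x) (S y) = S z"
    using sup xy by (meson imageE imageI)
  have "greatest L z (Lower L {x, y})"
    unfolding greatest_def Lower_def using xy z(1)
    by (auto simp: le z(2)[symmetric])
  then show "\<exists>s. greatest L s (Lower L {x, y})" ..
  let ?U = "{u \<in> S ` carrier L. u \<le> S x \<and> u \<le> S y}"
  have "finite ?U"
    by (rule finite_subset[OF _ fin[of "S x"]]) (use xy in auto)
  moreover have "b \<in> ?U" using bot xy by auto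
  ultimately obtain u where u: "u \<in> ?U" "\<And>w. w \<in> ?U \<Longrightarrow> u \<le> w \<Longrightarrow> u = w"
    using finite_has_maximal2[of ?U b] by blast
  \<comment> \<open>Closure under \<open>sup\<close> turns the maximal \<open>u\<close> into the
    greatest common lower bound of \<open>S x\<close> and \<open>S y\<close>, which is a join in the
    reversed order.\<close>
  have top: "w \<le> u" if "w \<in> ?U" for w
  proof -
    have "sup u w \<in> ?U" using sup u(1) that by auto
    then have "u = sup u w" using u(2) by simp
    then show ?thesis by (metis sup_ge2)
  qed
  obtain z where z: "z \<in> carrier L" "u = S z" using u(1) by auto
  have "least L z (Upper L {x, y})"
    unfolding least_def Upper_def using xy z u(1) top by (auto simp: le)
  then show "\<exists>s. least L s (Upper L {x, y})" ..
next
  show "x .=\<^bsub>L\<^esub> y" if "le L x y" "le L y x" "x \<in> carrier L" "y \<in> carrier L" for x y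
    using that inj unfolding eq by (meson antisym inj_onD le)
  show "le L x z" if "le L x y" "le L y z" "x \<in> carrier L" "y \<in> carrier L" "z \<in> carrier L" for x y z
    using that by (meson order_trans le)
qed (auto simp: eq le)

text \<open>
  The entries after position \<open>k\<close> has fired \<open>s k\<close> times for each \<open>k\<close>; they may be negative when
  \<open>s\<close> is not attainable. The truncation in \<open>j - m\<close> is harmless: \<open>j - m \<le> k\<close> iff \<open>j \<le> k + m\<close>.
\<close>

definition config :: "nat \<Rightarrow> (nat \<Rightarrow> nat) \<Rightarrow> (nat \<Rightarrow> nat) \<Rightarrow> nat \<Rightarrow> int" where
  "config m P s j = int (P j) - int m * int (s j) + (\<Sum>k\<in>{j - m..<j}. int (s k))"

lemma config_zero: "config m P (\<lambda>_. 0) j = int (P j)"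
  by (simp add: config_def)

lemma config_Suc:
  "config m P (s(i := Suc (s i))) j =
     config m P s j + (if j = i then - int m else if j \<in> {i + 1..i + m} then 1 else 0)"
proof -
  have "(\<Sum>k\<in>{j - m..<j}. int ((s(i := Suc (s i))) k))
      = (\<Sum>k\<in>{j - m..<j}. int (s k) + (if k = i then 1 else 0))"
    by (rule sum.cong) auto
  also have "\<dots> = (\<Sum>k\<in>{j - m..<j}. int (s k)) + (if i \<in> {j - m..<j} then 1 else 0)"
    by (simp add: sum.distrib)
  finally show ?thesis
    by (auto simp: config_def algebra_simps)
qed

text \<open>Entry \<open>j\<close> involves only \<open>s k\<close> with \<open>k \<le> j\<close>,
  and \<open>s j\<close> has the nonzero coefficient \<open>- m\<close>, so the equations can be
  solved from left to right.\<close>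

lemma config_inj:
  assumes "m \<ge> 1" and eq: "config m P s = config m P t"
  shows "s = t"
proof
  fix j
  show "s j = t j"
  proof (induction j rule: less_induct)
    case (less j)
    have "(\<Sum>k\<in>{j - m..<j}. int (s k)) = (\<Sum>k\<in>{j - m..<j}. int (t k))"
      using less by (intro sum.cong) auto
    then show ?case using fun_cong[OF eq, of j] \<open>m \<ge> 1\<close> by (simp add: config_def)
  qed
qed

definition enabled :: "nat \<Rightarrow> nat \<Rightarrow> (nat \<Rightarrow> nat) \<Rightarrow> (nat \<Rightarrow> nat) \<Rightarrow> nat \<Rightarrow> bool" where
  "enabled n m P s i \<longleftrightarrow>
     i \<in> {1..n} \<and> config m P s i \<ge> config m P s (i + 1) + (int m + 1)"

text \<open>The windows of \<open>i\<close> and \<open>i + 1\<close> overlap, and the last sum is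
  what remains: the single index \<open>i - m\<close>, or nothing if \<open>i < m\<close>. Only
  \<open>s i\<close> has a negative coefficient, which is the source of locality.\<close>

lemma config_diff:
  assumes "m \<ge> 1"
  shows "config m P s i - config m P s (i + 1) =
    int (P i) - int (P (i + 1)) - (int m + 1) * int (s i) + int m * int (s (i + 1))
      + (\<Sum>k\<in>{i - m..<Suc i - m}. int (s k))"
proof -
  have "(\<Sum>k\<in>{i - m..<i}. int (s k))
      = (\<Sum>k\<in>{i - m..<Suc i - m}. int (s k)) + (\<Sum>k\<in>{Suc i - m..<i}. int (s k))"
    using assms by (intro sum.atLeastLessThan_concat[symmetric]) auto
  moreover have "(\<Sum>k\<in>{Suc i - m..<Suc i}. int (s k))
      = (\<Sum>k\<in>{Suc i - m..<i}. int (s k)) + int (s i)"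
    using assms by (intro sum.atLeastLessThan_Suc) auto
  ultimately show ?thesis by (simp add: config_def algebra_simps)
qed

lemma enabled_local:
  assumes "m \<ge> 1" and en: "enabled n m P s i" and "s \<le> t" and eq: "t i = s i"
  shows "enabled n m P t i"
proof -
  have st: "s k \<le> t k" for k using \<open>s \<le> t\<close> by (simp add: le_fun_def)
  have "(\<Sum>k\<in>{i - m..<Suc i - m}. int (s k)) \<le> (\<Sum>k\<in>{i - m..<Suc i - m}. int (t k))"
    using st by (intro sum_mono) auto
  moreover have "int m * int (s (i + 1)) \<le> int m * int (t (i + 1))"
    using st by (intro mult_left_mono) auto
  ultimately show ?thesis
    using en config_diff[OF \<open>m \<ge> 1\<close>, of P s i] config_diff[OF \<open>m \<ge> 1\<close>, of P t i] eq
    unfolding enabled_def by auto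
qed

lemma allowed_iff_enabled:
  assumes "\<And>j. int (x j) = config m P s j"
  shows "allowed n m x i \<longleftrightarrow> enabled n m P s i"
  unfolding allowed_def enabled_def assms[symmetric] by auto

text \<open>Since \<open>allowed\<close> forces \<open>m \<le> x i\<close>, the truncated
  subtraction in \<open>fire\<close> is exact.\<close>

lemma fire_config:
  assumes "\<And>j. int (x j) = config m P s j" and "allowed n m x i"
  shows "int (fire m i x j) = config m P (s(i := Suc (s i))) j"
  using assms(2) unfolding config_Suc assms(1)[symmetric]
  by (auto simp: fire_def allowed_def of_nat_diff)

lemma cfg_steps_imp_shot:
  assumes "\<And>j. int (x j) = config m P s j" and "(cfg_step n m)\<^sup>*\<^sup>* x y"
  shows "\<exists>t. shot (enabled n m P) s t \<and> (\<forall>j. int (y j) = config m P t j)"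
  using assms(2)
proof induction
  case base
  then show ?case using assms(1) by (blast intro: shot.refl)
next
  case (step y z)
  then obtain t i where t: "shot (enabled n m P) s t" "\<And>j. int (y j) = config m P t j"
    and i: "allowed n m y i" "z = fire m i y"
    by (auto simp: cfg_step_def)
  then have "shot (enabled n m P) s (t(i := Suc (t i)))"
    by (simp add: shot.step allowed_iff_enabled[OF t(2)])
  then show ?case using fire_config[OF t(2) i(1)] i(2) by blast
qed

text \<open>Firing preserves partitions, so \<open>config\<close> stays nonnegative along a run from
  a partition and is realised by natural numbers.\<close>

lemma shot_imp_cfg_le:
  assumes "shot (enabled n m P) s t"
    and "is_partition n x" and "\<And>j. int (x j) = config m P s j"
  shows "\<exists>y. cfg_le n m y x \<and> (\<forall>j. int (y j) = config m P t j)"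
  using assms
proof induction
  case (refl s)
  then show ?case by (auto simp: cfg_le_def)
next
  case (step s t i)
  then obtain y where y: "cfg_le n m y x" "\<And>j. int (y j) = config m P t j"
    by blast
  have i: "allowed n m y i"
    using step.hyps(2) by (simp add: allowed_iff_enabled[OF y(2)])
  have py: "is_partition n y" using y(1) by (simp add: cfg_le_def)
  then have "cfg_step n m y (fire m i y)" using i by (auto simp: cfg_step_def)
  then have "cfg_le n m (fire m i y) x"
    using y(1) is_partition_fire[OF py i] unfolding cfg_le_def
    by (meson rtranclp.rtrancl_into_rtrancl)
  then show ?case using fire_config[OF y(2) i] by blast
qed

theorem theorem3:
  fixes n m :: nat and P :: "nat \<Rightarrow> nat"
  assumes "n \<ge> 1" and "m \<ge> 1" and "is_partition n P"
  shows "lattice (CFG P n m)"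
proof -
  let ?C = "carrier (CFG P n m)"
  let ?en = "enabled n m P"
  let ?R = "{s. shot ?en (\<lambda>_. 0) s}"
  have C: "b \<in> ?C \<longleftrightarrow> cfg_le n m b P" for b
    by (auto simp: CFG_def cfg_le_def)
  have local: "?en u i" if "?en t i" "t \<le> u" "u i = t i" for t u i
    using enabled_local[OF \<open>m \<ge> 1\<close>] that by blast
  have P0: "int (P j) = config m P (\<lambda>_. 0) j" for j
    by (simp add: config_zero)
  have "\<exists>s. s \<in> ?R \<and> (\<forall>j. int (b j) = config m P s j)" if "b \<in> ?C" for b
    using that cfg_steps_imp_shot[OF P0] by (auto simp: C cfg_le_def)
  \<comment> \<open>\<open>S b\<close> is the firing vector of \<open>b\<close>, unique by
    \<open>S_eq\<close> below.\<close>
  then obtain S where S: "\<And>b. b \<in> ?C \<Longrightarrow> S b \<in> ?R"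
    "\<And>b j. b \<in> ?C \<Longrightarrow> int (b j) = config m P (S b) j"
    by metis
  have S_eq: "S b = s" if "b \<in> ?C" "\<And>j. int (b j) = config m P s j" for b s
    using config_inj[OF \<open>m \<ge> 1\<close>, of P "S b" s] S(2) that by (metis ext)
  have config_eq: "b = c" if "\<And>j. int (b j) = config m P s j" "\<And>j. int (c j) = config m P s j"
    for b c s
    using that by (metis ext of_nat_eq_iff)
  have range: "S ` ?C = ?R"
  proof (intro equalityI subsetI)
    fix s assume "s \<in> ?R"
    then obtain b where "cfg_le n m b P" "\<And>j. int (b j) = config m P s j"
      using shot_imp_cfg_le[OF _ \<open>is_partition n P\<close> P0] by blast
    then show "s \<in> S ` ?C" using S_eq C by (metis imageI)
  qed (use S in auto)
  have le: "cfg_le n m b a \<longleftrightarrow> S a \<le> S b" if ab: "a \<in> ?C" "b \<in> ?C" for a b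
  proof
    assume "cfg_le n m b a"
    then obtain t where "shot ?en (S a) t" "\<And>j. int (b j) = config m P t j"
      using cfg_steps_imp_shot[OF S(2)[OF ab(1)]] unfolding cfg_le_def by blast
    then show "S a \<le> S b" using S_eq[OF ab(2)] shot_le by metis
  next
    assume ab_le: "S a \<le> S b"
    \<comment> \<open>The run from zero to \<open>S b\<close> is replayed on top of
      \<open>S a\<close>.\<close>
    have "shot ?en (S a) (sup (S a) (S b))"
      using shot_sup[of ?en "\<lambda>_. 0" "S b" "S a"] local S(1)[OF ab(2)] by (simp add: le_fun_def)
    then have "shot ?en (S a) (S b)" using ab_le by (simp add: sup_absorb2)
    moreover have "is_partition n a" using ab(1) by (simp add: C cfg_le_def)
    ultimately obtain y where "cfg_le n m y a" "\<And>j. int (y j) = config m P (S b) j"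
      using shot_imp_cfg_le S(2)[OF ab(1)] by blast
    then show "cfg_le n m b a" using config_eq S(2)[OF ab(2)] by metis
  qed
  show ?thesis
  proof (rule lattice_of_reversed_sup_closed[where S = S and b = "\<lambda>_. 0"], unfold range)
    show "inj_on S ?C"
      using S(2) config_eq by (intro inj_onI) metis
    show "sup u v \<in> ?R" if "u \<in> ?R" "v \<in> ?R" for u v
      using shot_sup[of ?en "\<lambda>_. 0" v u] local that shot_trans[of ?en u]
      by (simp add: le_fun_def)
    show "finite {u \<in> ?R. u \<le> v}" for v
    proof (rule finite_subset)
      \<comment> \<open>The sum is a crude bound on every \<open>v i\<close> with \<open>i\<close>
        in \<open>{1..n}\<close>: the finiteness lemma asks for one finite range common to all
        positions.\<close>
      show "{u \<in> ?R. u \<le> v} \<subseteq>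
          {f. \<forall>i. (i \<in> {1..n} \<longrightarrow> f i \<in> {..sum v {1..n}}) \<and> (i \<notin> {1..n} \<longrightarrow> f i = 0)}"
      proof (intro subsetI CollectI allI conjI impI)
        fix u i assume u: "u \<in> {u \<in> ?R. u \<le> v}"
        show "u i \<in> {..sum v {1..n}}" if "i \<in> {1..n}"
          using u that member_le_sum[of i "{1..n}" v] by (auto simp: le_fun_def intro: order_trans)
        show "u i = 0" if "i \<notin> {1..n}"
          using u that shot_unchanged[of ?en "\<lambda>_. 0" u i] by (auto simp: enabled_def)
      qed
    qed (intro finite_set_of_finite_funs; simp)
    show "eq (CFG P n m) = (=)" by (simp add: CFG_def)
    have "gorder.le (CFG P n m) = cfg_le n m" by (simp add: CFG_def)
    then show "gorder.le (CFG P n m) b a \<longleftrightarrow> S a \<le> S b" if "a \<in> ?C" "b \<in> ?C" for a b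
      using le[OF that] by simp
  qed (simp_all add: shot.refl le_fun_def)
qed

end
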